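(* Let $n\ge 5$ and let $F\in\{P_4,\,2K_2,\,C_3\}$. If $G$ has the maximum $Q$-index among all connected outerplanar graphs of order $n$ that do not contain $F$ as a subgraph, then $G\cong K_{1,n-1}$.
   Context: For a graph $G$, $Q(G)=D(G)+A(G)$ is the signless Laplacian matrix and the $Q$-index $q(G)$ is its largest eigenvalue. $P_4$ is the path on 4 vertices, $2K_2$ two disjoint edges, $C_3$ the triangle, and $K_{1,n-1}$ the star. A graph is outerplanar if it has a planar embedding with all vertices on the boundary of the outer face. *)

theory Defs
  imports "HOL-Analysis.Analysis"
begin

type_synonym 'a graph = "'a set \<times> 'a set set"

definition verts :: "'a graph \<Rightarrow> 'a set" where "verts G = fst G"
definition edges :: "'a graph \<Rightarrow> 'a set set" where "edges G = snd G"

definition simple_graph :: "'a graph \<Rightarrow> bool" where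
  "simple_graph G \<longleftrightarrow> finite (verts G) \<and>
     (\<forall>e\<in>edges G. e \<subseteq> verts G \<and> card e = 2)"

definition adj :: "'a graph \<Rightarrow> 'a \<Rightarrow> 'a \<Rightarrow> bool" where
  "adj G u v \<longleftrightarrow> {u, v} \<in> edges G"

definition connected_graph :: "'a graph \<Rightarrow> bool" where
  "connected_graph G \<longleftrightarrow> verts G \<noteq> {} \<and>
     (\<forall>u\<in>verts G. \<forall>v\<in>verts G. (adj G)\<^sup>*\<^sup>* u v)"

definition degree :: "'a graph \<Rightarrow> 'a \<Rightarrow> nat" where
  "degree G u = card {e \<in> edges G. u \<in> e}"

definition signless_laplacian :: "'a graph \<Rightarrow> 'a \<Rightarrow> 'a \<Rightarrow> real" where
  "signless_laplacian G u v =
     (if u = v then real (degree G u) else if adj G u v then 1 else 0)"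

definition is_Q_eigenvalue :: "'a graph \<Rightarrow> real \<Rightarrow> bool" where
  "is_Q_eigenvalue G mu \<longleftrightarrow>
     (\<exists>x :: 'a \<Rightarrow> real. (\<exists>v\<in>verts G. x v \<noteq> 0) \<and>
        (\<forall>u\<in>verts G. (\<Sum>v\<in>verts G. signless_laplacian G u v * x v) = mu * x u))"

text \<open>Q-index: the largest eigenvalue of Q(G) (Q(G) is real symmetric, so all
  its eigenvalues are real).\<close>
definition Q_index :: "'a graph \<Rightarrow> real" where
  "Q_index G = Max {mu. is_Q_eigenvalue G mu}"

definition contains_subgraph :: "'a graph \<Rightarrow> 'b graph \<Rightarrow> bool" where
  "contains_subgraph G F \<longleftrightarrow>
     (\<exists>f. inj_on f (verts F) \<and> f ` verts F \<subseteq> verts G \<and>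
          (\<forall>e\<in>edges F. f ` e \<in> edges G))"

definition graph_iso :: "'a graph \<Rightarrow> 'b graph \<Rightarrow> bool" where
  "graph_iso G H \<longleftrightarrow>
     (\<exists>f. bij_betw f (verts G) (verts H) \<and>
          (\<forall>u\<in>verts G. \<forall>v\<in>verts G. {u, v} \<in> edges G \<longleftrightarrow> {f u, f v} \<in> edges H))"

definition outerplanar_drawing ::
  "'a graph \<Rightarrow> ('a \<Rightarrow> complex) \<Rightarrow> ('a set \<Rightarrow> real \<Rightarrow> complex) \<Rightarrow> bool" where
  "outerplanar_drawing G p \<gamma> \<longleftrightarrow>
     inj_on p (verts G) \<and>
     (\<forall>e\<in>edges G. arc (\<gamma> e) \<and>
        {pathstart (\<gamma> e), pathfinish (\<gamma> e)} = p ` e \<and>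
        path_image (\<gamma> e) \<inter> p ` verts G = p ` e) \<and>
     (\<forall>e\<in>edges G. \<forall>e'\<in>edges G. e \<noteq> e' \<longrightarrow>
        path_image (\<gamma> e) \<inter> path_image (\<gamma> e') \<subseteq> p ` (e \<inter> e')) \<and>
     (let D = p ` verts G \<union> (\<Union>e\<in>edges G. path_image (\<gamma> e)) in
       \<exists>z. z \<notin> D \<and> \<not> bounded (connected_component_set (- D) z) \<and>
           (\<forall>v\<in>verts G. p v \<in> frontier (connected_component_set (- D) z)))"

definition outerplanar :: "'a graph \<Rightarrow> bool" where
  "outerplanar G \<longleftrightarrow> (\<exists>p \<gamma>. outerplanar_drawing G p \<gamma>)"

definition P4 :: "nat graph" where
  "P4 = ({0,1,2,3}, {{0,1},{1,2},{2,3}})"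

definition two_K2 :: "nat graph" where
  "two_K2 = ({0,1,2,3}, {{0,1},{2,3}})"

definition C3 :: "nat graph" where
  "C3 = ({0,1,2}, {{0,1},{1,2},{0,2}})"

definition star_graph :: "nat \<Rightarrow> nat graph" where
  "star_graph n = ({..<n}, {{0, i} | i. 0 < i \<and> i < n})"

end

theory Submission
  imports Defs
begin

text \<open>
A connected \<open>P\<^sub>4\<close>-free graph on at least four vertices is a star, and a \<open>2K\<^sub>2\<close>-free graph is \<open>P\<^sub>4\<close>-free, so only
\<open>C\<^sub>3\<close> needs spectral input. There the star, whose \<open>Q\<close>-index is at least \<open>n\<close>, competes, so
\<open>q(G) \<ge> n\<close>; but \<open>q(G) \<le> max (deg a + deg b) \<le> n\<close> over the edges \<open>ab\<close> of a triangle-free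
graph. Tightness at one edge and its neighbours makes \<open>G\<close> complete bipartite, and a complete bipartite
graph on at least five vertices is a star or contains \<open>K\<^sub>2\<^sub>,\<^sub>3\<close>. The latter is not outerplanar: of the three
arcs of a theta curve, one runs inside the Jordan curve formed by the other two, hence off the outer face.
\<close>

section \<open>Eigenvalues of real symmetric matrices\<close>

lemma symmetric_bilinear_swap:
  fixes M :: "'a \<Rightarrow> 'a \<Rightarrow> real"
  assumes "\<And>u v. M u v = M v u"
  shows "(\<Sum>u\<in>V. (\<Sum>v\<in>V. M u v * x v) * y u) = (\<Sum>u\<in>V. (\<Sum>v\<in>V. M u v * y v) * x u)"
proof -
  have "(\<Sum>u\<in>V. (\<Sum>v\<in>V. M u v * x v) * y u) = (\<Sum>u\<in>V. \<Sum>v\<in>V. M u v * x v * y u)"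
    by (simp add: sum_distrib_right)
  also have "\<dots> = (\<Sum>v\<in>V. \<Sum>u\<in>V. M u v * x v * y u)"
    by (rule sum.swap)
  also have "\<dots> = (\<Sum>v\<in>V. (\<Sum>u\<in>V. M v u * y u) * x v)"
    unfolding sum_distrib_right
    by (intro sum.cong refl) (metis assms mult.assoc mult.commute)
  finally show ?thesis .
qed

text \<open>Bessel's inequality at the coordinate vector of \<open>v\<close> bounds the sum of the
  squares \<open>(x i v)\<^sup>2\<close> by 1. Summing over \<open>v \<in> V\<close> counts every
  unit vector once on the left and gives at most \<open>card V\<close> on the right.\<close>

lemma orthonormal_family_card_le:
  fixes x :: "'i \<Rightarrow> 'a \<Rightarrow> real"
  assumes "finite V" "finite T"
    and ortho: "\<And>i j. i \<in> T \<Longrightarrow> j \<in> T \<Longrightarrow> (\<Sum>w\<in>V. x i w * x j w) = (if i = j then 1 else 0)"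
  shows "card T \<le> card V"
proof -
  have bessel: "(\<Sum>i\<in>T. (x i v)\<^sup>2) \<le> 1" if v: "v \<in> V" for v
  proof -
    \<comment> \<open>\<open>?p\<close> is the orthogonal projection of the coordinate vector
      \<open>?d\<close> onto the span of the family. Its squared norm and its inner product with
      \<open>?d\<close> are both the sum to be bounded, so the squared distance from
      \<open>?d\<close> to \<open>?p\<close> is 1 minus that sum.\<close>
    let ?p = "\<lambda>w. \<Sum>i\<in>T. x i v * x i w"
    let ?d = "\<lambda>w. if w = v then 1 else 0 :: real"
    have a: "(\<Sum>w\<in>V. ?d w * ?p w) = (\<Sum>i\<in>T. (x i v)\<^sup>2)"
      using v \<open>finite V\<close> by (simp add: if_distrib[of "\<lambda>a. a * _"] sum.delta power2_eq_square cong: if_cong)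
    have d: "(\<Sum>w\<in>V. (?d w)\<^sup>2) = 1"
      using v \<open>finite V\<close> by (simp add: if_distrib[of "\<lambda>a. a ^ 2"] sum.delta cong: if_cong)
    have "(\<Sum>w\<in>V. (?p w)\<^sup>2) = (\<Sum>w\<in>V. \<Sum>i\<in>T. \<Sum>j\<in>T. (x i v * x j v) * (x i w * x j w))"
      unfolding power2_eq_square sum_product by (intro sum.cong refl) (simp add: algebra_simps)
    also have "\<dots> = (\<Sum>i\<in>T. \<Sum>w\<in>V. \<Sum>j\<in>T. (x i v * x j v) * (x i w * x j w))"
      by (rule sum.swap)
    also have "\<dots> = (\<Sum>i\<in>T. \<Sum>j\<in>T. \<Sum>w\<in>V. (x i v * x j v) * (x i w * x j w))"
      by (intro sum.cong refl sum.swap)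
    also have "\<dots> = (\<Sum>i\<in>T. \<Sum>j\<in>T. (x i v * x j v) * (\<Sum>w\<in>V. x i w * x j w))"
      by (simp add: sum_distrib_left)
    also have "\<dots> = (\<Sum>i\<in>T. \<Sum>j\<in>T. (x i v * x j v) * (if i = j then 1 else 0))"
      by (intro sum.cong refl) (use ortho in simp)
    also have "\<dots> = (\<Sum>i\<in>T. (x i v)\<^sup>2)"
      using \<open>finite T\<close> by (simp add: if_distrib[of "\<lambda>a. _ * a"] sum.delta power2_eq_square cong: if_cong)
    finally have p: "(\<Sum>w\<in>V. (?p w)\<^sup>2) = (\<Sum>i\<in>T. (x i v)\<^sup>2)" .
    have "0 \<le> (\<Sum>w\<in>V. (?d w - ?p w)\<^sup>2)"
      by (intro sum_nonneg) auto
    also have "\<dots> = (\<Sum>w\<in>V. (?d w)\<^sup>2) + (\<Sum>w\<in>V. (?p w)\<^sup>2) - 2 * (\<Sum>w\<in>V. ?d w * ?p w)"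
      by (simp only: power2_diff sum.distrib sum_subtractf sum_distrib_left mult.assoc)
    finally show ?thesis using a d p by linarith
  qed
  have "real (card T) = (\<Sum>i\<in>T. \<Sum>w\<in>V. (x i w)\<^sup>2)"
    using ortho by (simp add: power2_eq_square)
  also have "\<dots> = (\<Sum>w\<in>V. \<Sum>i\<in>T. (x i w)\<^sup>2)"
    by (rule sum.swap)
  also have "\<dots> \<le> (\<Sum>w\<in>V. 1)"
    by (intro sum_mono bessel)
  finally show ?thesis by simp
qed

text \<open>Eigenvectors of distinct eigenvalues are orthogonal. After normalising, any finite set
  of eigenvalues yields an orthonormal family, whose size is at most \<open>card V\<close>.\<close>

lemma symmetric_eigenvalues_finite:
  fixes M :: "'a \<Rightarrow> 'a \<Rightarrow> real"
  assumes "finite V" and sym: "\<And>u v. M u v = M v u"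
  shows "finite {\<mu>. \<exists>x. (\<exists>v\<in>V. x v \<noteq> 0) \<and> (\<forall>u\<in>V. (\<Sum>v\<in>V. M u v * x v) = \<mu> * x u)}"
    (is "finite ?S")
proof -
  have "card T \<le> card V" if T: "T \<subseteq> ?S" "finite T" for T
  proof -
    obtain x where x: "\<And>\<mu>. \<mu> \<in> T \<Longrightarrow> (\<exists>v\<in>V. x \<mu> v \<noteq> 0) \<and>
        (\<forall>u\<in>V. (\<Sum>v\<in>V. M u v * x \<mu> v) = \<mu> * x \<mu> u)"
      using T(1) by (subst (asm) subset_eq, simp) metis
    define N where "N \<mu> = sqrt (\<Sum>v\<in>V. (x \<mu> v)\<^sup>2)" for \<mu>
    have pos: "(\<Sum>v\<in>V. (x \<mu> v)\<^sup>2) > 0" if "\<mu> \<in> T" for \<mu>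
      using x[OF that] \<open>finite V\<close> by (meson sum_pos2 zero_le_power2 zero_less_power2)
    show ?thesis
    proof (rule orthonormal_family_card_le[where x = "\<lambda>\<mu> v. x \<mu> v / N \<mu>"])
      fix \<mu> \<nu> assume \<mu>\<nu>: "\<mu> \<in> T" "\<nu> \<in> T"
      have s: "(\<Sum>w\<in>V. x \<mu> w / N \<mu> * (x \<nu> w / N \<nu>)) = (\<Sum>w\<in>V. x \<mu> w * x \<nu> w) / (N \<mu> * N \<nu>)"
        by (simp add: sum_divide_distrib)
      show "(\<Sum>w\<in>V. x \<mu> w / N \<mu> * (x \<nu> w / N \<nu>)) = (if \<mu> = \<nu> then 1 else 0)"
      proof (cases "\<mu> = \<nu>")
        case True
        have "N \<mu> * N \<mu> = (\<Sum>w\<in>V. (x \<mu> w)\<^sup>2)"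
          using pos[OF \<mu>\<nu>(1)] unfolding N_def by simp
        then show ?thesis using True s pos[OF \<mu>\<nu>(1)] by (simp add: power2_eq_square)
      next
        case False
        \<comment> \<open>Symmetry moves \<open>M\<close> from one factor of the inner product to
          the other, so both eigenvalues multiply it to the same number. As they differ, the inner
          product is 0.\<close>
        have "\<mu> * (\<Sum>w\<in>V. x \<mu> w * x \<nu> w) = (\<Sum>u\<in>V. (\<Sum>v\<in>V. M u v * x \<mu> v) * x \<nu> u)"
          using x[OF \<mu>\<nu>(1)] by (simp add: sum_distrib_left mult.assoc)
        also have "\<dots> = (\<Sum>u\<in>V. (\<Sum>v\<in>V. M u v * x \<nu> v) * x \<mu> u)"
          by (rule symmetric_bilinear_swap[OF sym])
        also have "\<dots> = \<nu> * (\<Sum>w\<in>V. x \<mu> w * x \<nu> w)"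
          using x[OF \<mu>\<nu>(2)] by (simp add: sum_distrib_left algebra_simps)
        finally show ?thesis using False s by simp
      qed
    qed (use assms T in auto)
  qed
  then show ?thesis
    using finite_if_finite_subsets_card_bdd by blast
qed

text \<open>A maximiser of the quadratic form \<open>q\<close> on the unit sphere is an eigenvector
  (Rayleigh quotient), with the maximum as eigenvalue.\<close>

lemma symmetric_eigenvalue_exists:
  fixes M :: "'a \<Rightarrow> 'a \<Rightarrow> real"
  assumes "finite V" "V \<noteq> {}" and sym: "\<And>u v. M u v = M v u"
  shows "\<exists>\<mu> x. (\<exists>v\<in>V. x v \<noteq> 0) \<and> (\<forall>u\<in>V. (\<Sum>v\<in>V. M u v * x v) = \<mu> * x u)"
proof -
  define q where "q x = (\<Sum>u\<in>V. (\<Sum>v\<in>V. M u v * x v) * x u)" for x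
  define nn where "nn x = (\<Sum>u\<in>V. (x u)\<^sup>2)" for x :: "'a \<Rightarrow> real"
  \<comment> \<open>Vectors are functions on the whole type, so coordinates outside \<open>V\<close>
    are pinned to 0. The box is then compact by Tychonoff's theorem, and it contains the unit sphere
    of the vectors supported on \<open>V\<close>.\<close>
  define K where "K = (PiE UNIV (\<lambda>v. if v \<in> V then {-1..1} else {0}) :: ('a \<Rightarrow> real) set)"
  have "compactin (product_topology (\<lambda>i. euclidean) UNIV) K"
    unfolding K_def compactin_PiE by auto
  then have cK: "compact K"
    by (simp add: euclidean_product_topology)
  have cont: "continuous_on UNIV (\<lambda>x::'a \<Rightarrow> real. x v)" for v
    by (rule continuous_on_product_coordinates)
  have cq: "continuous_on UNIV q" and cn: "continuous_on UNIV nn"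
    unfolding q_def nn_def by (intro continuous_intros cont)+
  have "closed {x. nn x = 1}"
    using closed_Collect_eq[OF cn continuous_on_const] .
  with cK have cS: "compact (K \<inter> {x. nn x = 1})"
    by (rule compact_Int_closed)
  obtain a where a: "a \<in> V" using assms by auto
  have "(\<lambda>v. if v = a then 1 else 0) \<in> K \<inter> {x. nn x = 1}"
    using a \<open>finite V\<close>
    by (auto simp: K_def nn_def if_distrib[of "\<lambda>t. t ^ 2"] sum.delta cong: if_cong)
  then have "K \<inter> {x. nn x = 1} \<noteq> {}" by blast
  then have "\<exists>x\<in>K \<inter> {x. nn x = 1}. \<forall>y\<in>K \<inter> {x. nn x = 1}. q y \<le> q x"
    using continuous_attains_sup[OF cS _ continuous_on_subset[OF cq]] by simp
  then obtain x where x: "x \<in> K" "nn x = 1"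
    and mx: "\<And>y. y \<in> K \<Longrightarrow> nn y = 1 \<Longrightarrow> q y \<le> q x"
    by blast
  \<comment> \<open>Homogeneity extends the maximum from the sphere to all \<open>y\<close>:
    rescaling and cutting \<open>y\<close> off outside \<open>V\<close> lands in \<open>K\<close>,
    and \<open>q\<close> and \<open>nn\<close> read only the coordinates in
    \<open>V\<close>.\<close>
  have le: "q y \<le> q x * nn y" for y
  proof (cases "nn y = 0")
    case True
    then have "\<forall>v\<in>V. y v = 0"
      unfolding nn_def using \<open>finite V\<close> by (simp add: sum_nonneg_eq_0_iff)
    then show ?thesis using True by (simp add: q_def)
  next
    case False
    then have pos: "nn y > 0"
      unfolding nn_def by (metis less_eq_real_def sum_nonneg zero_le_power2)
    define z where "z v = (if v \<in> V then y v / sqrt (nn y) else 0)" for v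
    have nz: "nn z = 1"
      using pos by (simp add: nn_def z_def power_divide sum_divide_distrib[symmetric])
    have "(z v)\<^sup>2 \<le> 1" if "v \<in> V" for v
      using nz member_le_sum[OF that, of "\<lambda>v. (z v)\<^sup>2"] \<open>finite V\<close> unfolding nn_def by simp
    then have "\<bar>z v\<bar> \<le> 1" if "v \<in> V" for v
      using that by (simp add: abs_square_le_1)
    then have "z v \<in> (if v \<in> V then {-1..1} else {0})" for v
      by (cases "v \<in> V") (auto simp: abs_le_iff minus_le_iff, simp add: z_def)
    then have "z \<in> K"
      unfolding K_def by (simp add: PiE_iff)
    then have "q z \<le> q x" using mx nz by blast
    moreover have "q z = q y / nn y"
    proof -
      have "q z = (\<Sum>u\<in>V. (\<Sum>v\<in>V. M u v * y v) * y u / (sqrt (nn y) * sqrt (nn y)))"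
        unfolding q_def z_def by (intro sum.cong refl) (simp add: sum_divide_distrib[symmetric])
      also have "\<dots> = q y / nn y"
        using pos by (simp add: q_def sum_divide_distrib[symmetric])
      finally show ?thesis .
    qed
    ultimately show ?thesis using pos by (simp add: field_simps)
  qed
  have "(\<Sum>v\<in>V. M w v * x v) = q x * x w" if w: "w \<in> V" for w
  proof -
    \<comment> \<open>First-order condition: moving \<open>x\<close> by \<open>t\<close> along the
      coordinate vector \<open>e\<close> turns \<open>le\<close> into a quadratic in
      \<open>t\<close> that is nonnegative everywhere and vanishes at 0, so its linear coefficient
      \<open>2 * g\<close> must vanish.\<close>
    define g where "g = q x * x w - (\<Sum>v\<in>V. M w v * x v)"
    define e where "e v = (if v = w then 1 else 0 :: real)" for v
    define c where "c = q x - M w w"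
    have "0 \<le> 2 * t * g + t\<^sup>2 * c" for t
    proof -
      have Me: "(\<Sum>v\<in>V. M u v * e v) = M u w" for u
        using w \<open>finite V\<close> by (simp add: e_def if_distrib[of "\<lambda>s. _ * s"] sum.delta cong: if_cong)
      have fe: "(\<Sum>u\<in>V. f u * e u) = f w" for f :: "'a \<Rightarrow> real"
        using w \<open>finite V\<close> by (simp add: e_def if_distrib[of "\<lambda>s. _ * s"] sum.delta cong: if_cong)
      have "q (\<lambda>v. x v + t * e v) =
          (\<Sum>u\<in>V. ((\<Sum>v\<in>V. M u v * x v) + t * M u w) * (x u + t * e u))"
        unfolding q_def Me[symmetric] by (simp add: sum.distrib sum_distrib_left algebra_simps)
      also have "\<dots> = q x + t * (\<Sum>u\<in>V. (\<Sum>v\<in>V. M u v * x v) * e u)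
          + t * (\<Sum>u\<in>V. M u w * x u) + t * t * (\<Sum>u\<in>V. M u w * e u)"
      proof -
        define r where "r u = (\<Sum>v\<in>V. M u v * x v)" for u
        have "(\<Sum>u\<in>V. (r u + t * M u w) * (x u + t * e u)) =
            (\<Sum>u\<in>V. r u * x u + t * (r u * e u) + t * (M u w * x u) + t * t * (M u w * e u))"
          by (intro sum.cong refl) (simp add: algebra_simps)
        then show ?thesis
          unfolding q_def r_def[symmetric] by (simp add: sum.distrib sum_distrib_left)
      qed
      also have "\<dots> = q x + 2 * t * (\<Sum>v\<in>V. M w v * x v) + t\<^sup>2 * M w w"
      proof -
        have "(\<Sum>u\<in>V. M u w * x u) = (\<Sum>u\<in>V. M w u * x u)"
          by (intro sum.cong refl) (metis sym)
        then show ?thesis by (simp add: fe power2_eq_square)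
      qed
      finally have 1: "q (\<lambda>v. x v + t * e v) = q x + 2 * t * (\<Sum>v\<in>V. M w v * x v) + t\<^sup>2 * M w w" .
      have "nn (\<lambda>v. x v + t * e v) = nn x + 2 * t * (\<Sum>v\<in>V. x v * e v) + t\<^sup>2 * (\<Sum>v\<in>V. e v * e v)"
        unfolding nn_def by (simp add: power2_eq_square algebra_simps sum.distrib sum_distrib_left)
      also have "\<dots> = 1 + 2 * t * x w + t\<^sup>2"
        unfolding fe by (simp add: x e_def)
      finally have "q x + 2 * t * (\<Sum>v\<in>V. M w v * x v) + t\<^sup>2 * M w w \<le> q x * (1 + 2 * t * x w + t\<^sup>2)"
        using le[of "\<lambda>v. x v + t * e v"] 1 by simp
      then show ?thesis
        unfolding g_def c_def by (simp add: algebra_simps)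
    qed
    note quad = this
    have "g = 0"
    proof (rule ccontr)
      assume g: "g \<noteq> 0"
      \<comment> \<open>\<open>k\<close> is large enough that the step \<open>t = - g / k\<close>
        makes the linear term outweigh the quadratic one, whatever the sign of
        \<open>c\<close>.\<close>
      define k where "k = \<bar>c\<bar> + 1"
      have "k > 0" unfolding k_def by (simp add: add_nonneg_pos)
      moreover have "c \<le> k" unfolding k_def by (simp add: add_increasing2)
      ultimately have k: "k > 0" "c < 2 * k" by simp_all
      have "0 \<le> 2 * (- g / k) * g + (- g / k)\<^sup>2 * c" by (rule quad)
      also have "\<dots> = (g\<^sup>2 / k\<^sup>2) * (c - 2 * k)"
        using k by (simp add: power2_eq_square field_simps)
      also have "\<dots> < 0"
        using g k by (intro mult_pos_neg) auto
      finally show False by simp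
    qed
    then show ?thesis by (simp add: g_def)
  qed
  moreover have "\<exists>v\<in>V. x v \<noteq> 0"
  proof (rule ccontr)
    assume "\<not> ?thesis"
    then have "nn x = 0" by (simp add: nn_def)
    then show False using x by simp
  qed
  ultimately show ?thesis by blast
qed

section \<open>Theta curves\<close>

text \<open>An arc without its endpoints is connected and here avoids \<open>C\<close>, so it lies
  in a single component of the complement. One point inside \<open>C\<close> therefore brings all of
  them inside.\<close>

lemma inside_meets_open_arc:
  fixes c :: "real \<Rightarrow> complex"
  assumes "arc c" "pathstart c = a" "pathfinish c = b" "path_image c \<inter> C = {a, b}"
    and "path_image c \<inter> inside C \<noteq> {}" "w \<in> path_image c - {a, b}"
  shows "w \<in> inside C"
proof -
  obtain x where x: "x \<in> path_image c" "x \<in> inside C"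
    using assms by auto
  then have "x \<notin> C" by (auto simp: inside_def)
  then have xc: "x \<in> path_image c - {a, b}"
    using x assms(4) by auto
  have "connected (path_image c - {a, b})"
    using connected_simple_path_endless[of c] assms by (simp add: arc_imp_simple_path)
  moreover have "path_image c - {a, b} \<subseteq> - C"
    using assms(4) by auto
  ultimately have "connected_component (- C) x w"
    using xc assms(6) unfolding connected_component_def by blast
  then show ?thesis
    using inside_same_component x(2) by blast
qed

text \<open>Running along \<open>c\<close> and back along \<open>d\<close> is a simple closed curve,
  to which the Jordan curve theorem applies.\<close>

lemma inside_outside_of_arcs:
  fixes c d :: "real \<Rightarrow> complex"
  assumes "arc c" "pathstart c = a" "pathfinish c = b"
    and "arc d" "pathstart d = a" "pathfinish d = b"
    and "path_image c \<inter> path_image d = {a, b}"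
  shows "inside (path_image c \<union> path_image d) \<noteq> {}"
    and "connected (inside (path_image c \<union> path_image d))"
    and "frontier (inside (path_image c \<union> path_image d)) = path_image c \<union> path_image d"
    and "connected (outside (path_image c \<union> path_image d))"
proof -
  have "simple_path (c +++ reversepath d)"
    using assms by (intro simple_path_join_loop) (auto simp: arc_reversepath)
  from Jordan_inside_outside[OF this]
  show "inside (path_image c \<union> path_image d) \<noteq> {}"
    and "connected (inside (path_image c \<union> path_image d))"
    and "frontier (inside (path_image c \<union> path_image d)) = path_image c \<union> path_image d"
    and "connected (outside (path_image c \<union> path_image d))"
    using assms by (simp_all add: path_image_join)
qed

text \<open>If \<open>c1\<close> does not enter the region inside \<open>c2\<close> and
  \<open>c3\<close>, that region misses all three arcs. If it lies inside the curve of
  \<open>c1\<close> and \<open>c2\<close>, its boundary drags \<open>c3\<close> along; the curve of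
  \<open>c1\<close> and \<open>c3\<close> is symmetric. Lying outside both curves is ruled out by
  Janiszewski's theorem.\<close>

lemma theta_curve_arc_inside:
  fixes c1 c2 c3 :: "real \<Rightarrow> complex"
  assumes c1: "arc c1" "pathstart c1 = a" "pathfinish c1 = b"
    and c2: "arc c2" "pathstart c2 = a" "pathfinish c2 = b"
    and c3: "arc c3" "pathstart c3 = a" "pathfinish c3 = b"
    and i12: "path_image c1 \<inter> path_image c2 = {a, b}"
    and i13: "path_image c1 \<inter> path_image c3 = {a, b}"
    and i23: "path_image c2 \<inter> path_image c3 = {a, b}"
    and w1: "w1 \<in> path_image c1 - {a, b}"
    and w2: "w2 \<in> path_image c2 - {a, b}"
    and w3: "w3 \<in> path_image c3 - {a, b}"
  shows "w1 \<in> inside (path_image c2 \<union> path_image c3) \<or>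
    w2 \<in> inside (path_image c1 \<union> path_image c3) \<or>
    w3 \<in> inside (path_image c1 \<union> path_image c2)"
proof (cases "path_image c1 \<inter> inside (path_image c2 \<union> path_image c3) = {}")
  case False
  have "path_image c1 \<inter> (path_image c2 \<union> path_image c3) = {a, b}"
    using i12 i13 by auto
  from inside_meets_open_arc[OF c1 this False w1] show ?thesis by simp
next
  case True
  let ?A = "path_image c1" and ?B = "path_image c2" and ?C = "path_image c3"
  have comp: "compact ?A" "compact ?B" "compact ?C"
    using c1 c2 c3 by (simp_all add: compact_arc_image)
  note J23 = inside_outside_of_arcs[OF c2 c3 i23]
  note J12 = inside_outside_of_arcs[OF c1 c2 i12]
  note J13 = inside_outside_of_arcs[OF c1 c3 i13]
  obtain x where x: "x \<in> inside (?B \<union> ?C)" using J23 by auto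
  have sub: "inside (?B \<union> ?C) \<subseteq> - (?A \<union> ?B \<union> ?C)"
    using True inside_no_overlap[of "?B \<union> ?C"] by blast
  \<comment> \<open>The region inside \<open>?B \<union> ?C\<close> is connected and avoids
    \<open>D\<close>, so the position of its point \<open>x\<close> decides the position of the
    whole region.\<close>
  have trap: "inside (?B \<union> ?C) \<subseteq> inside D" if "x \<in> inside D" "D \<subseteq> ?A \<union> ?B \<union> ?C" for D
  proof
    fix y assume y: "y \<in> inside (?B \<union> ?C)"
    have "inside (?B \<union> ?C) \<subseteq> - D" using sub that by auto
    then have "connected_component (- D) x y"
      using J23(2) x y unfolding connected_component_def by blast
    then show "y \<in> inside D" using that inside_same_component by blast
  qed
  \<comment> \<open>By the Jordan curve theorem every point of \<open>c2\<close> and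
    \<open>c3\<close> is a limit of the region, so these arcs follow it into the closure of any set
    that contains it.\<close>
  have cl: "?B \<union> ?C \<subseteq> closure (inside (?B \<union> ?C))"
    using J23(3) by (metis frontier_def Diff_subset)
  show ?thesis
  proof (cases "x \<in> inside (?A \<union> ?B)")
    case True
    then have "inside (?B \<union> ?C) \<subseteq> inside (?A \<union> ?B)" by (rule trap) auto
    then have "w3 \<in> closure (inside (?A \<union> ?B))"
      using cl w3 closure_mono by blast
    then have "w3 \<in> ?A \<union> ?B \<union> inside (?A \<union> ?B)"
      using closure_inside_subset[of "?A \<union> ?B"] comp
      by (meson closed_Un compact_imp_closed subsetD)
    then show ?thesis using w3 i13 i23 by auto
  next
    case notB: False
    show ?thesis
    proof (cases "x \<in> inside (?A \<union> ?C)")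
      case True
      then have "inside (?B \<union> ?C) \<subseteq> inside (?A \<union> ?C)" by (rule trap) auto
      then have "w2 \<in> closure (inside (?A \<union> ?C))"
        using cl w2 closure_mono by blast
      then have "w2 \<in> ?A \<union> ?C \<union> inside (?A \<union> ?C)"
        using closure_inside_subset[of "?A \<union> ?C"] comp
      by (meson closed_Un compact_imp_closed subsetD)
      then show ?thesis using w2 i12 i23 by auto
    next
      case notC: False
      have out: "x \<in> outside (?A \<union> ?B)" "x \<in> outside (?A \<union> ?C)"
        using notB notC sub x inside_Un_outside by blast+
      have "bounded (?A \<union> ?B \<union> ?C)"
        using comp by (simp add: compact_imp_bounded)
      \<comment> \<open>\<open>z\<close> stands for infinity: it is outside each of the three closed
        curves, in particular outside the one that encloses \<open>x\<close>.\<close>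
      then obtain z where z: "z \<in> outside (?A \<union> ?B \<union> ?C)"
        using outside_bounded_nonempty by blast
      have zo: "z \<in> outside (?A \<union> ?B)" "z \<in> outside (?A \<union> ?C)" "z \<in> outside (?B \<union> ?C)"
        using z outside_mono[of _ "?A \<union> ?B \<union> ?C"] by blast+
      have "connected_component (- (?A \<union> ?B)) x z"
        using J12(4) out(1) zo(1) outside_no_overlap[of "?A \<union> ?B"]
        unfolding connected_component_def by blast
      moreover have "connected_component (- (?A \<union> ?C)) x z"
        using J13(4) out(2) zo(2) outside_no_overlap[of "?A \<union> ?C"]
        unfolding connected_component_def by blast
      \<comment> \<open>Janiszewski's theorem joins \<open>x\<close> to \<open>z\<close> off the
        union of two compact sets when neither set alone separates them and their intersection is
        connected. Here the intersection is the arc \<open>c1\<close>.\<close>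
      moreover have "(?A \<union> ?B) \<inter> (?A \<union> ?C) = ?A"
        using i12 i13 i23 by auto
      ultimately have "connected_component (- ((?A \<union> ?B) \<union> (?A \<union> ?C))) x z"
        using comp c1(1)
        by - (rule Janiszewski, simp_all only: compact_Un closed_Un compact_imp_closed connected_arc_image)
      then have "connected_component (- (?B \<union> ?C)) x z"
        by (rule connected_component_of_subset) auto
      then have "z \<in> inside (?B \<union> ?C)"
        using x inside_same_component by blast
      then show ?thesis
        using zo(3) inside_Int_outside by blast
    qed
  qed
qed

text \<open>An unbounded component of the complement of \<open>D\<close> lies outside
  \<open>S\<close>, and the closure of the outside adds only points of \<open>S\<close>. In a
  drawing, no vertex enclosed by part of the drawing can be on the outer face.\<close>

lemma inside_not_frontier_unbounded_component:
  fixes S D :: "complex set"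
  assumes "closed S" "S \<subseteq> D" "\<not> bounded (connected_component_set (- D) z)" "w \<in> inside S"
  shows "w \<notin> frontier (connected_component_set (- D) z)"
proof
  assume w: "w \<in> frontier (connected_component_set (- D) z)"
  have mono: "connected_component_set (- D) z \<subseteq> connected_component_set (- S) z"
    using assms(2) by (intro connected_component_mono) auto
  have "connected_component_set (- D) z \<noteq> {}"
    using assms(3) bounded_empty by metis
  then have "z \<notin> S"
    using assms(2) connected_component_eq_empty[of "- D" z] by blast
  then have "z \<in> outside S"
    using assms(3) mono bounded_subset unfolding outside_def by blast
  then have "connected_component_set (- D) z \<subseteq> outside S"
    using mono outside_same_component by blast
  then have "w \<in> closure (outside S)"
    using w closure_mono unfolding frontier_def by blast
  then show False
    using closure_outside_subset[OF assms(1)] assms(4) inside_Int_outside inside_no_overlap by blast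
qed

section \<open>Signless Laplacians of graphs\<close>

definition nbrs :: "'a graph \<Rightarrow> 'a \<Rightarrow> 'a set" where
  "nbrs G u = {v. adj G u v}"

lemma adj_commute: "adj G u v \<longleftrightarrow> adj G v u"
  by (simp add: adj_def insert_commute)

lemma adj_simple_graph:
  assumes "simple_graph G" "adj G u v"
  shows "u \<in> verts G" "v \<in> verts G" "u \<noteq> v"
  using assms unfolding simple_graph_def adj_def by fastforce+

lemma edge_simple_graphE:
  assumes "simple_graph G" "e \<in> edges G"
  obtains u v where "e = {u, v}" "u \<noteq> v" "adj G u v"
  using assms unfolding simple_graph_def adj_def by (metis card_2_iff)

lemma finite_nbrs: "simple_graph G \<Longrightarrow> finite (nbrs G u)"
  by (rule finite_subset[of _ "verts G"])
    (auto simp: nbrs_def simple_graph_def[of G, THEN iffD1] adj_simple_graph)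

lemma degree_eq_card_nbrs:
  assumes "simple_graph G"
  shows "degree G u = card (nbrs G u)"
proof -
  have "inj_on (\<lambda>v. {u, v}) (nbrs G u)"
    by (auto simp: inj_on_def doubleton_eq_iff)
  moreover have "{e \<in> edges G. u \<in> e} = (\<lambda>v. {u, v}) ` nbrs G u"
  proof
    show "{e \<in> edges G. u \<in> e} \<subseteq> (\<lambda>v. {u, v}) ` nbrs G u"
    proof
      fix e assume e: "e \<in> {e \<in> edges G. u \<in> e}"
      then obtain a b where "e = {a, b}" "adj G a b"
        using edge_simple_graphE[OF assms] by blast
      then show "e \<in> (\<lambda>v. {u, v}) ` nbrs G u"
        using e by (auto simp: nbrs_def adj_commute)
    qed
  qed (auto simp: nbrs_def adj_def)
  ultimately show ?thesis
    unfolding degree_def by (simp add: card_image)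
qed

text \<open>The diagonal entry is the number of neighbours, so it supplies one copy of
  \<open>x u\<close> for each of them. Rows become sums of edge values \<open>x u + x v\<close>, the
  form used in all later eigenvalue arguments.\<close>

lemma signless_laplacian_row:
  assumes G: "simple_graph G" and u: "u \<in> verts G"
  shows "(\<Sum>v\<in>verts G. signless_laplacian G u v * x v) = (\<Sum>v\<in>nbrs G u. x u + x v)"
proof -
  have fin: "finite (verts G)" using G by (simp add: simple_graph_def)
  have "(\<Sum>v\<in>verts G. signless_laplacian G u v * x v) =
      (\<Sum>v\<in>verts G. (if v = u then degree G u * x v else 0) + (if v \<in> nbrs G u then x v else 0))"
    using adj_simple_graph(3)[OF G] unfolding signless_laplacian_def nbrs_def
    by (intro sum.cong refl) auto
  also have "\<dots> = degree G u * x u + (\<Sum>v\<in>verts G \<inter> nbrs G u. x v)"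
    using fin u by (simp add: sum.distrib sum.inter_restrict)
  also have "verts G \<inter> nbrs G u = nbrs G u"
    using adj_simple_graph[OF G] by (auto simp: nbrs_def)
  also have "degree G u * x u + (\<Sum>v\<in>nbrs G u. x v) = (\<Sum>v\<in>nbrs G u. x u + x v)"
    by (simp add: degree_eq_card_nbrs[OF G] sum.distrib)
  finally show ?thesis .
qed

lemma signless_laplacian_commute: "signless_laplacian G u v = signless_laplacian G v u"
  by (simp add: signless_laplacian_def adj_commute)

lemma finite_Q_eigenvalues: "simple_graph G \<Longrightarrow> finite {\<mu>. is_Q_eigenvalue G \<mu>}"
  unfolding is_Q_eigenvalue_def
  by (rule symmetric_eigenvalues_finite) (simp_all add: simple_graph_def signless_laplacian_commute)

text \<open>\<open>Max\<close> is attained only on a finite nonempty set; the two results on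
  symmetric matrices provide finiteness and nonemptiness.\<close>

lemma Q_index_is_eigenvalue:
  assumes "simple_graph G" "verts G \<noteq> {}"
  shows "is_Q_eigenvalue G (Q_index G)"
proof -
  have "\<exists>\<mu>. is_Q_eigenvalue G \<mu>"
    unfolding is_Q_eigenvalue_def using assms
    by (intro symmetric_eigenvalue_exists) (simp_all add: simple_graph_def signless_laplacian_commute)
  then show ?thesis
    unfolding Q_index_def using Max_in[OF finite_Q_eigenvalues[OF assms(1)]] by auto
qed

lemma Q_index_ge: "simple_graph G \<Longrightarrow> is_Q_eigenvalue G \<mu> \<Longrightarrow> \<mu> \<le> Q_index G"
  unfolding Q_index_def by (intro Max_ge finite_Q_eigenvalues) simp_all

section \<open>The star graph and its eigenvalue \<open>n\<close>\<close>

lemma verts_star_graph [simp]: "verts (star_graph n) = {..<n}"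
  by (simp add: star_graph_def verts_def)

lemma edges_star_graph: "edges (star_graph n) = {{0, i} | i. 0 < i \<and> i < n}"
  by (simp add: star_graph_def edges_def)

lemma adj_star_graph:
  "adj (star_graph n) u v \<longleftrightarrow> (u = 0 \<and> 0 < v \<and> v < n) \<or> (v = 0 \<and> 0 < u \<and> u < n)"
  by (auto simp: adj_def edges_star_graph doubleton_eq_iff)

lemma simple_star_graph: "simple_graph (star_graph n)"
  by (auto simp: simple_graph_def edges_star_graph)

lemma connected_star_graph:
  assumes "n > 0"
  shows "connected_graph (star_graph n)"
proof -
  have "(adj (star_graph n))\<^sup>*\<^sup>* u 0 \<and> (adj (star_graph n))\<^sup>*\<^sup>* 0 u" if "u < n" for u
    using that by (cases "u = 0") (auto simp: adj_star_graph)
  then show ?thesis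
    using assms unfolding connected_graph_def by (auto intro: rtranclp_trans)
qed

lemma star_graph_no_C3: "\<not> contains_subgraph (star_graph n) C3"
proof
  assume "contains_subgraph (star_graph n) C3"
  then obtain f where f: "inj_on f {0, 1, 2::nat}"
    "{f 0, f 1} \<in> edges (star_graph n)" "{f 1, f 2} \<in> edges (star_graph n)" "{f 0, f 2} \<in> edges (star_graph n)"
    unfolding contains_subgraph_def C3_def verts_def edges_def by auto
  then show False
    using adj_star_graph unfolding adj_def by (metis less_numeral_extra(3))
qed

lemma is_Q_eigenvalue_star_graph:
  assumes "n \<ge> 2"
  shows "is_Q_eigenvalue (star_graph n) (real n)"
proof -
  \<comment> \<open>With \<open>n - 1\<close> at the centre and 1 at the leaves every edge value is
    \<open>n\<close>. The centre has \<open>n - 1\<close> edges and a leaf has one, so each row sum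
    is \<open>n\<close> times the entry of \<open>x\<close>.\<close>
  define x where "x i = (if i = 0 then real n - 1 else 1)" for i :: nat
  have x: "(\<Sum>v\<in>{..<n}. signless_laplacian (star_graph n) u v * x v) = real n * x u" if u: "u < n" for u
  proof -
    have "(\<Sum>v\<in>{..<n}. signless_laplacian (star_graph n) u v * x v) = (\<Sum>v\<in>nbrs (star_graph n) u. x u + x v)"
      using signless_laplacian_row[OF simple_star_graph, of u n x] u by simp
    also have "\<dots> = real n * x u"
    proof (cases "u = 0")
      case True
      have "nbrs (star_graph n) u = {1..<n}"
        using True by (auto simp: nbrs_def adj_star_graph)
      then show ?thesis using True assms by (simp add: x_def of_nat_diff)
    next
      case False
      have "nbrs (star_graph n) u = {0}"
        using False u by (auto simp: nbrs_def adj_star_graph)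
      then show ?thesis using False by (simp add: x_def)
    qed
    finally show ?thesis .
  qed
  have "\<exists>v\<in>{..<n}. x v \<noteq> 0"
    using assms by (intro bexI[of _ 1]) (auto simp: x_def)
  then show ?thesis
    unfolding is_Q_eigenvalue_def using x by auto
qed

section \<open>Outerplanarity of stars and complete bipartite graphs\<close>

text \<open>The three paths from \<open>u\<close> to \<open>v\<close> through the \<open>w\<close>'s
  are drawn as a theta curve. One of the three middle vertices is then enclosed by the other two
  paths and cannot be on the outer face.\<close>

lemma outerplanar_no_K23:
  assumes G: "simple_graph G" and "outerplanar G" and "u \<noteq> v"
    and dist: "w1 \<noteq> w2" "w1 \<noteq> w3" "w2 \<noteq> w3"
    and adj: "\<forall>w\<in>{w1, w2, w3}. adj G u w \<and> adj G w v"
  shows False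
proof -
  obtain p \<gamma> where d: "outerplanar_drawing G p \<gamma>"
    using assms by (auto simp: outerplanar_def)
  define D where "D = p ` verts G \<union> (\<Union>e\<in>edges G. path_image (\<gamma> e))"
  have inj: "inj_on p (verts G)"
    and ends: "\<And>e. e \<in> edges G \<Longrightarrow> arc (\<gamma> e) \<and> {pathstart (\<gamma> e), pathfinish (\<gamma> e)} = p ` e"
    and img: "\<And>e. e \<in> edges G \<Longrightarrow> path_image (\<gamma> e) \<inter> p ` verts G = p ` e"
    and cross: "\<And>e e'. e \<in> edges G \<Longrightarrow> e' \<in> edges G \<Longrightarrow> e \<noteq> e' \<Longrightarrow>
        path_image (\<gamma> e) \<inter> path_image (\<gamma> e') \<subseteq> p ` (e \<inter> e')"
    using d unfolding outerplanar_drawing_def by simp_all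
  obtain z where z: "\<not> bounded (connected_component_set (- D) z)"
      "\<And>v. v \<in> verts G \<Longrightarrow> p v \<in> frontier (connected_component_set (- D) z)"
    using d unfolding outerplanar_drawing_def Let_def D_def[symmetric] by (elim conjE exE) simp
  \<comment> \<open>A drawing fixes the two endpoints of an edge arc but not its direction, so
    \<open>g a b\<close> reverses the arc where necessary to run from \<open>a\<close> to
    \<open>b\<close>.\<close>
  define g where "g a b = (if pathstart (\<gamma> {a, b}) = p a then \<gamma> {a, b} else reversepath (\<gamma> {a, b}))" for a b
  have g: "arc (g a b)" "pathstart (g a b) = p a" "pathfinish (g a b) = p b"
      "path_image (g a b) = path_image (\<gamma> {a, b})" if "adj G a b" for a b
    using ends[of "{a, b}"] that
    by (auto simp: g_def adj_def arc_reversepath doubleton_eq_iff)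
  define c where "c w = g u w +++ g w v" for w
  have W: "adj G u w" "adj G w v" "u \<noteq> w" "w \<noteq> v" "{u, w} \<in> edges G" "{w, v} \<in> edges G"
      "u \<in> verts G" "v \<in> verts G" "w \<in> verts G" if "w \<in> {w1, w2, w3}" for w
    using adj that adj_simple_graph[OF G] unfolding adj_def by blast+
  have im: "path_image (c w) = path_image (\<gamma> {u, w}) \<union> path_image (\<gamma> {w, v})"
    if w: "w \<in> {w1, w2, w3}" for w
    using W[OF w] g by (simp add: c_def path_image_join)
  have c: "arc (c w)" "pathstart (c w) = p u" "pathfinish (c w) = p v"
    if w: "w \<in> {w1, w2, w3}" for w
  proof -
    have "{u, w} \<noteq> {w, v}" "{u, w} \<inter> {w, v} = {w}"
      using W[OF w] \<open>u \<noteq> v\<close> by (auto simp: doubleton_eq_iff)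
    then have "path_image (\<gamma> {u, w}) \<inter> path_image (\<gamma> {w, v}) \<subseteq> {p w}"
      using cross[OF W(5)[OF w] W(6)[OF w]] by auto
    then show "arc (c w)"
      unfolding c_def using W[OF w] g by (intro arc_join) auto
  qed (use W[OF w] g in \<open>auto simp: c_def\<close>)
  have pin: "p u \<in> path_image (c w)" "p v \<in> path_image (c w)" if "w \<in> {w1, w2, w3}" for w
    using c[OF that] pathstart_in_path_image pathfinish_in_path_image by metis+
  have int: "path_image (c w) \<inter> path_image (c w') = {p u, p v}"
    if w: "w \<in> {w1, w2, w3}" and w': "w' \<in> {w1, w2, w3}" and "w \<noteq> w'" for w w'
  proof
    have "path_image (\<gamma> {u, w}) \<inter> path_image (\<gamma> {u, w'}) \<subseteq> {p u}"
         "path_image (\<gamma> {w, v}) \<inter> path_image (\<gamma> {w', v}) \<subseteq> {p v}"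
         "path_image (\<gamma> {u, w}) \<inter> path_image (\<gamma> {w', v}) \<subseteq> {}"
         "path_image (\<gamma> {w, v}) \<inter> path_image (\<gamma> {u, w'}) \<subseteq> {}"
      using cross[OF W(5)[OF w] W(5)[OF w']] cross[OF W(6)[OF w] W(6)[OF w']]
        cross[OF W(5)[OF w] W(6)[OF w']] cross[OF W(6)[OF w] W(5)[OF w']] W[OF w] W[OF w'] \<open>u \<noteq> v\<close> \<open>w \<noteq> w'\<close>
      by (auto simp: doubleton_eq_iff)
    then show "path_image (c w) \<inter> path_image (c w') \<subseteq> {p u, p v}"
      unfolding im[OF w] im[OF w'] by blast
  qed (use pin[OF w] pin[OF w'] in auto)
  have mem: "p w \<in> path_image (c w) - {p u, p v}" if w: "w \<in> {w1, w2, w3}" for w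
  proof -
    have "p w \<in> path_image (\<gamma> {u, w})" using img[OF W(5)[OF w]] by auto
    then show ?thesis
      using im[OF w] W[OF w] inj by (auto simp: inj_on_eq_iff)
  qed
  have no: "p w \<notin> inside (path_image (c w') \<union> path_image (c w''))"
    if "w \<in> {w1, w2, w3}" "w' \<in> {w1, w2, w3}" "w'' \<in> {w1, w2, w3}" for w w' w''
  proof
    assume i: "p w \<in> inside (path_image (c w') \<union> path_image (c w''))"
    have "closed (path_image (c w') \<union> path_image (c w''))"
      using c that by (intro closed_Un closed_arc_image) auto
    moreover have "path_image (c w') \<union> path_image (c w'') \<subseteq> D"
      using im[OF that(2)] im[OF that(3)] W(5,6)[OF that(2)] W(5,6)[OF that(3)] unfolding D_def by blast
    ultimately show False
      using inside_not_frontier_unbounded_component[OF _ _ z(1) i] z(2) W(9)[OF that(1)] by blast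
  qed
  show False
    using theta_curve_arc_inside[OF c[of w1] c[of w2] c[of w3] int int int mem[of w1] mem[of w2] mem[of w3]]
      no[of w1 w2 w3] no[of w2 w1 w3] no[of w3 w1 w2] dist by simp
qed

text \<open>The centre is drawn at the origin, leaf \<open>i\<close> at height \<open>i\<close> on
  the line of real part 1, and edges as straight segments. Distinct slopes keep the edges apart away
  from the origin.\<close>

lemma outerplanar_star_graph:
  assumes "n > 0"
  shows "outerplanar (star_graph n)"
proof -
  define p where "p i = (if i = 0 then 0 else Complex 1 (real i))" for i :: nat
  \<comment> \<open>The centre is vertex 0, so \<open>Max e\<close> is the leaf of the edge
    \<open>e\<close>.\<close>
  define \<gamma> where "\<gamma> e = linepath 0 (p (Max e))" for e
  have p0: "p 0 = 0" by (simp add: p_def)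
  have pi: "p i = Complex 1 (real i)" if "i > 0" for i using that by (simp add: p_def)
  have edge: "path_image (\<gamma> {0, i}) = {Complex t (t * real i) | t. 0 \<le> t \<and> t \<le> 1}" if "i > 0" for i
  proof -
    have "path_image (\<gamma> {0, i}) = {t *\<^sub>R p i | t. 0 \<le> t \<and> t \<le> 1}"
      by (simp add: \<gamma>_def closed_segment_def)
    also have "(\<lambda>t. t *\<^sub>R p i) = (\<lambda>t. Complex t (t * real i))"
      using that by (auto simp: pi complex_eq_iff)
    finally show ?thesis .
  qed
  define D where "D = p ` {..<n} \<union> (\<Union>e\<in>edges (star_graph n). path_image (\<gamma> e))"
  have D: "0 \<le> Re w \<and> Re w \<le> 1 \<and> 0 \<le> Im w" if "w \<in> D" for w
    using that unfolding D_def edges_star_graph by (auto simp: edge p_def split: if_splits)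
  \<comment> \<open>The drawing lies in the half-strip described by \<open>D\<close>. The three
    half-planes around it are joined by the lower one, so \<open>U\<close> is a connected part of
    the outer face.\<close>
  define U where "U = {w. Re w < 0} \<union> ({w. Re w > 1} \<union> {w. Im w < 0})"
  have UD: "U \<subseteq> - D"
    using D unfolding U_def by fastforce
  have "Complex 2 (-1) \<in> {w. Re w > 1} \<inter> {w. Im w < 0}"
    "Complex (-1) (-1) \<in> {w. Re w < 0} \<inter> ({w. Re w > 1} \<union> {w. Im w < 0})" by auto
  then have "connected U"
    unfolding U_def
    by (intro connected_Un convex_connected convex_halfspace_Re_lt convex_halfspace_Re_gt convex_halfspace_Im_lt) blast+
  moreover have z: "-1 \<in> U" by (simp add: U_def)
  ultimately have UC: "U \<subseteq> connected_component_set (- D) (-1)"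
    using UD by (intro connected_component_maximal)
  have unb: "\<not> bounded (connected_component_set (- D) (-1))"
  proof
    assume "bounded (connected_component_set (- D) (-1))"
    then obtain B where B: "\<And>w. w \<in> U \<Longrightarrow> norm w \<le> B"
      using UC unfolding bounded_iff by blast
    \<comment> \<open>A point of \<open>U\<close> shows that the bound \<open>B\<close> is
      nonnegative; then \<open>B + 2\<close> is a real point of \<open>U\<close> with norm exceeding
      \<open>B\<close>.\<close>
    have "Complex 2 0 \<in> U" by (simp add: U_def)
    then have "B \<ge> 0" using B norm_ge_zero order_trans by blast
    have "Complex (B + 2) 0 \<in> U" using \<open>B \<ge> 0\<close> by (simp add: U_def)
    then have "norm (Complex (B + 2) 0) \<le> B" by (rule B)
    then show False using abs_Re_le_cmod[of "Complex (B + 2) 0"] by simp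
  qed
  have fr: "p v \<in> frontier (connected_component_set (- D) (-1))" if v: "v < n" for v
  proof -
    \<comment> \<open>The centre is approached horizontally from the left, and a leaf from the
      right.\<close>
    have "p v \<in> closure U"
      unfolding closure_approachable
    proof (intro allI impI)
      fix e :: real assume "e > 0"
      show "\<exists>y\<in>U. dist y (p v) < e"
      proof (cases "v = 0")
        case True
        then show ?thesis using \<open>e > 0\<close>
          by (intro bexI[of _ "complex_of_real (- e / 2)"]) (auto simp: U_def p_def dist_norm)
      next
        case False
        then show ?thesis using \<open>e > 0\<close>
          by (intro bexI[of _ "p v + complex_of_real (e / 2)"]) (auto simp: U_def p_def dist_norm)
      qed
    qed
    then have "p v \<in> closure (connected_component_set (- D) (-1))"
      using closure_mono[OF UC] by blast
    moreover have "p v \<notin> connected_component_set (- D) (-1)"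
      using v connected_component_subset[of "- D" "-1"] unfolding D_def by blast
    ultimately show ?thesis
      unfolding frontier_def using interior_subset by blast
  qed
  have "outerplanar_drawing (star_graph n) p \<gamma>"
    unfolding outerplanar_drawing_def verts_star_graph Let_def D_def[symmetric]
  proof (intro conjI ballI impI)
    show "inj_on p {..<n}"
      by (auto simp: inj_on_def p_def complex_eq_iff split: if_splits)
    show "\<exists>z. z \<notin> D \<and> \<not> bounded (connected_component_set (- D) z) \<and>
        (\<forall>v\<in>{..<n}. p v \<in> frontier (connected_component_set (- D) z))"
      using z UD unb fr by (intro exI[of _ "-1"]) auto
  next
    fix e assume "e \<in> edges (star_graph n)"
    then obtain i where i: "e = {0, i}" "0 < i" "i < n" by (auto simp: edges_star_graph)
    have "p i \<noteq> 0" using i by (simp add: p_def complex_eq_iff)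
    then show "arc (\<gamma> e)" using i by (simp add: \<gamma>_def)
    show "{pathstart (\<gamma> e), pathfinish (\<gamma> e)} = p ` e" using i by (simp add: \<gamma>_def p0)
    show "path_image (\<gamma> e) \<inter> p ` {..<n} = p ` e"
    proof
      show "path_image (\<gamma> e) \<inter> p ` {..<n} \<subseteq> p ` e"
        using i by (auto simp: edge p_def complex_eq_iff split: if_splits)
      have "p 0 \<in> path_image (\<gamma> e)" "p i \<in> path_image (\<gamma> e)"
        using i by (auto simp: edge p_def complex_eq_iff)
      then show "p ` e \<subseteq> path_image (\<gamma> e) \<inter> p ` {..<n}" using i by auto
    qed
  next
    fix e e' assume "e \<in> edges (star_graph n)" "e' \<in> edges (star_graph n)" "e \<noteq> e'"
    then obtain i j where i: "e = {0, i}" "0 < i" "i < n" and j: "e' = {0, j}" "0 < j" "j < n" "i \<noteq> j"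
      unfolding edges_star_graph by blast
    have "w = 0" if "w \<in> path_image (\<gamma> e) \<inter> path_image (\<gamma> e')" for w
    proof -
      have "Im w = Re w * real i" "Im w = Re w * real j"
        using that i j by (auto simp: edge)
      then have "Re w = 0" using j by simp
      then show ?thesis using \<open>Im w = Re w * real i\<close> by (simp add: complex_eq_iff)
    qed
    then show "path_image (\<gamma> e) \<inter> path_image (\<gamma> e') \<subseteq> p ` (e \<inter> e')"
      using i j p0 by (auto intro!: image_eqI[of _ _ 0])
  qed
  then show ?thesis unfolding outerplanar_def by blast
qed

section \<open>Extremal graphs\<close>

text \<open>Leaves are interchangeable: any bijection from the other vertices to
  \<open>{1..<n}\<close> works once \<open>c\<close> is sent to 0.\<close>

lemma graph_iso_star_graphI:
  assumes G: "simple_graph G" and "card (verts G) = n" and c: "c \<in> verts G"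
    and adj: "\<And>u v. u \<in> verts G \<Longrightarrow> v \<in> verts G \<Longrightarrow> adj G u v \<longleftrightarrow> u \<noteq> v \<and> (u = c \<or> v = c)"
  shows "graph_iso G (star_graph n)"
proof -
  have fin: "finite (verts G)" using G by (simp add: simple_graph_def)
  then have n: "n > 0" using assms by (auto simp: card_gt_0_iff)
  have "card (verts G - {c}) = card {1..<n}"
    using assms fin by (simp add: card_Diff_singleton)
  then obtain h where h: "bij_betw h (verts G - {c}) {1..<n}"
    using fin by (metis finite_Diff finite_atLeastLessThan finite_same_card_bij)
  define f where "f v = (if v = c then 0 else h v)" for v
  have "bij_betw f (verts G - {c}) {1..<n}"
    using h by (rule bij_betw_cong[THEN iffD1, rotated]) (simp add: f_def)
  moreover have "bij_betw f {c} {0}" by (simp add: f_def)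
  ultimately have "bij_betw f ((verts G - {c}) \<union> {c}) ({1..<n} \<union> {0})"
    by (rule bij_betw_combine) auto
  moreover have "(verts G - {c}) \<union> {c} = verts G" "{1..<n} \<union> {0} = {..<n}"
    using c n by auto
  ultimately have bij: "bij_betw f (verts G) {..<n}" by simp
  have "{u, v} \<in> edges G \<longleftrightarrow> {f u, f v} \<in> edges (star_graph n)"
    if uv: "u \<in> verts G" "v \<in> verts G" for u v
  proof -
    have lt: "f u < n" "f v < n" using bij uv by (auto simp: bij_betw_def)
    have eq: "f u = 0 \<longleftrightarrow> u = c" "f v = 0 \<longleftrightarrow> v = c" "f u = f v \<longleftrightarrow> u = v"
      using bij uv c by (metis bij_betw_def f_def inj_on_eq_iff)+
    have "{f u, f v} \<in> edges (star_graph n) \<longleftrightarrow> f u \<noteq> f v \<and> (f u = 0 \<or> f v = 0)"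
      using adj_star_graph[of n "f u" "f v"] lt unfolding adj_def by auto
    then show ?thesis using adj[OF uv] eq unfolding adj_def by auto
  qed
  then show ?thesis
    unfolding graph_iso_def using bij by auto
qed

text \<open>A walk from a vertex in \<open>S\<close> to one outside must leave \<open>S\<close> at
  some step.\<close>

lemma connected_graph_boundary_edge:
  assumes "connected_graph G" "S \<subset> verts G" "S \<noteq> {}"
  obtains u v where "u \<in> S" "v \<notin> S" "adj G u v"
proof -
  obtain a b where ab: "a \<in> S" "b \<in> verts G" "b \<notin> S" using assms by blast
  then have "(adj G)\<^sup>*\<^sup>* a b" using assms unfolding connected_graph_def by blast
  moreover have "\<exists>u\<in>S. \<exists>v. v \<notin> S \<and> adj G u v" if "(adj G)\<^sup>*\<^sup>* a b" "b \<notin> S" for b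
    using that by (induction rule: rtranclp_induct) (use ab in auto)
  ultimately show ?thesis using ab that by blast
qed

section \<open>Excluded subgraphs and the \<open>P4\<close>-free case\<close>

lemma contains_P4I:
  assumes G: "simple_graph G" and adj: "adj G a b" "adj G b c" "adj G c d"
    and "distinct [a, b, c, d]"
  shows "contains_subgraph G P4"
  unfolding contains_subgraph_def
proof (intro exI conjI)
  let ?f = "\<lambda>i::nat. if i = 0 then a else if i = 1 then b else if i = 2 then c else d"
  show "inj_on ?f (verts P4)" using assms(5) by (auto simp: P4_def verts_def inj_on_def)
  show "?f ` verts P4 \<subseteq> verts G"
    using adj_simple_graph[OF G] adj by (auto simp: P4_def verts_def[of "(_, _)"])
  show "\<forall>e\<in>edges P4. ?f ` e \<in> edges G"
    using adj by (auto simp: P4_def edges_def[of "(_, _)"] adj_def insert_commute)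
qed

lemma contains_C3I:
  assumes G: "simple_graph G" and adj: "adj G a b" "adj G b c" "adj G a c"
  shows "contains_subgraph G C3"
  unfolding contains_subgraph_def
proof (intro exI conjI)
  let ?f = "\<lambda>i::nat. if i = 0 then a else if i = 1 then b else c"
  show "inj_on ?f (verts C3)"
    using adj_simple_graph(3)[OF G] adj by (auto simp: C3_def verts_def inj_on_def)
  show "?f ` verts C3 \<subseteq> verts G"
    using adj_simple_graph[OF G] adj by (auto simp: C3_def verts_def[of "(_, _)"])
  show "\<forall>e\<in>edges C3. ?f ` e \<in> edges G"
    using adj by (auto simp: C3_def edges_def[of "(_, _)"] adj_def insert_commute)
qed

lemma contains_P4_imp_two_K2:
  assumes "contains_subgraph G P4"
  shows "contains_subgraph G two_K2"
proof -
  have "verts two_K2 = verts P4" "edges two_K2 \<subseteq> edges P4"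
    by (auto simp: P4_def two_K2_def verts_def edges_def)
  then show ?thesis using assms unfolding contains_subgraph_def by (metis subsetD)
qed

text \<open>Connectedness provides a vertex \<open>c\<close> with two neighbours. A vertex at
  distance two from \<open>c\<close>, or an edge between two neighbours of \<open>c\<close>, would
  complete a path on four vertices.\<close>

lemma connected_P4_free_imp_star:
  assumes G: "simple_graph G" and n: "card (verts G) = n" "n \<ge> 4" and con: "connected_graph G"
    and free: "\<not> contains_subgraph G P4"
  shows "graph_iso G (star_graph n)"
proof -
  have fin: "finite (verts G)" using G by (simp add: simple_graph_def)
  have proper: "S \<subset> verts G" if "S \<subseteq> verts G" "card S < n" for S
    using that n by blast
  obtain s where s: "s \<in> verts G" using con by (auto simp: connected_graph_def)
  obtain t where st: "adj G s t" "s \<noteq> t"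
    using connected_graph_boundary_edge[OF con proper[of "{s}"]] s n by auto
  have tv: "t \<in> verts G" using adj_simple_graph[OF G st(1)] by simp
  \<comment> \<open>A third vertex \<open>r'\<close> is attached to the edge \<open>s t\<close>; the
    end \<open>r\<close> at which it is attached becomes the centre \<open>c\<close>.\<close>
  obtain r r' where r: "r \<in> {s, t}" "r' \<notin> {s, t}" "adj G r r'"
    using connected_graph_boundary_edge[OF con proper[of "{s, t}"]] s tv n st by auto
  obtain c a b where c: "adj G c a" "adj G c b" "a \<noteq> b"
  proof (cases "r = s")
    case True
    then show ?thesis using that[of s t r'] r st by auto
  next
    case False
    then show ?thesis using that[of t s r'] r st by (auto simp: adj_commute)
  qed
  have cv: "c \<in> verts G" using adj_simple_graph[OF G c(1)] by simp
  have all: "insert c (nbrs G c) = verts G"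
  proof (rule ccontr)
    assume "insert c (nbrs G c) \<noteq> verts G"
    then have "insert c (nbrs G c) \<subset> verts G"
      using cv adj_simple_graph[OF G] by (auto simp: nbrs_def)
    then obtain d w where d: "d \<in> insert c (nbrs G c)" "w \<notin> insert c (nbrs G c)" "adj G d w"
      using connected_graph_boundary_edge[OF con] by blast
    \<comment> \<open>\<open>d\<close> is not \<open>c\<close>, since otherwise \<open>w\<close>
      would be a neighbour of \<open>c\<close>. A second neighbour \<open>e\<close> of
      \<open>c\<close> then completes the path \<open>w\<close>, \<open>d\<close>, \<open>c\<close>,
      \<open>e\<close>.\<close>
    then have dc: "adj G c d" by (auto simp: nbrs_def)
    obtain e where e: "adj G c e" "e \<noteq> d" using c by metis
    have "distinct [w, d, c, e]"
      using d dc e adj_simple_graph(3)[OF G] by (auto simp: nbrs_def)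
    then show False
      using contains_P4I[OF G, of w d c e] d(3) dc e free by (simp add: adj_commute)
  qed
  have indep: False if "adj G u v" "u \<in> nbrs G c" "v \<in> nbrs G c" for u v
  proof -
    \<comment> \<open>Here \<open>n \<ge> 4\<close> excludes the triangle: a fourth vertex
      \<open>w\<close> hangs on \<open>c\<close> and gives the path \<open>w\<close>,
      \<open>c\<close>, \<open>u\<close>, \<open>v\<close>.\<close>
    have "card {c, u, v} < n" using card_insert_le_m1 n by (simp add: card_insert_if)
    then have "{c, u, v} \<subset> verts G" using that cv all by (intro proper) auto
    then obtain w where w: "w \<in> verts G" "w \<notin> {c, u, v}" by blast
    then have "adj G w c" using all by (auto simp: nbrs_def adj_commute)
    moreover have "adj G c u" "c \<noteq> v" "c \<noteq> u" "u \<noteq> v"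
      using that adj_simple_graph(3)[OF G] by (auto simp: nbrs_def)
    ultimately show False
      using contains_P4I[OF G, of w c u v] that(1) w free by auto
  qed
  show ?thesis
  proof (rule graph_iso_star_graphI[OF G n(1) cv])
    fix u v assume "u \<in> verts G" "v \<in> verts G"
    then show "adj G u v \<longleftrightarrow> u \<noteq> v \<and> (u = c \<or> v = c)"
      using all indep[of u v] adj_simple_graph(3)[OF G] unfolding nbrs_def
      by (metis adj_commute insert_iff mem_Collect_eq)
  qed
qed

text \<open>
The signless Laplacian acts on the edge sums \<open>x a + x b\<close> like a nonnegative matrix (of the line graph) with row
sums \<open>deg a + deg b\<close>. At an edge where \<open>\<bar>x a + x b\<bar>\<close> is maximal the row-sum bound must be an
equality, which forces the adjacent edges to be maximal too.
\<close>

lemma Q_eigenvalue_ge_degree_sums_tight: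
  assumes G: "simple_graph G" and eig: "is_Q_eigenvalue G \<mu>" and "\<mu> > 0"
    and deg: "\<And>a b. adj G a b \<Longrightarrow> real (degree G a) + real (degree G b) \<le> \<mu>"
  obtains u v where "adj G u v" "\<And>w. adj G u w \<Longrightarrow> real (degree G u) + real (degree G w) = \<mu>"
proof -
  have fin: "finite (verts G)" using G by (simp add: simple_graph_def)
  obtain x where x0: "\<exists>v\<in>verts G. x v \<noteq> 0"
    and x: "\<And>u. u \<in> verts G \<Longrightarrow> (\<Sum>v\<in>nbrs G u. x u + x v) = \<mu> * x u"
    using eig signless_laplacian_row[OF G] unfolding is_Q_eigenvalue_def by metis
  define y where "y = (\<lambda>(a, b). \<bar>x a + x b\<bar>)"
  define E where "E = {(a, b). adj G a b}"
  have "E \<subseteq> verts G \<times> verts G" using adj_simple_graph[OF G] by (auto simp: E_def)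
  then have finE: "finite E" using fin finite_subset by blast
  obtain s where s: "s \<in> verts G" "x s \<noteq> 0" using x0 by blast
  \<comment> \<open>If all edge values at \<open>s\<close> vanished, so would
    \<open>\<mu> * x s\<close>. Hence the maximum \<open>m\<close> below is positive and can be
    cancelled.\<close>
  obtain t where t: "adj G s t" "x s + x t \<noteq> 0"
  proof (rule ccontr)
    assume "\<not> thesis"
    then have "(\<Sum>v\<in>nbrs G s. x s + x v) = 0"
      using that by (intro sum.neutral) (auto simp: nbrs_def)
    then show False using x[OF s(1)] s(2) \<open>\<mu> > 0\<close> by simp
  qed
  have "(s, t) \<in> E" using t by (simp add: E_def)
  then have "Max (y ` E) \<in> y ` E" using finE by (intro Max_in) auto
  then obtain u v where uv: "(u, v) \<in> E" "Max (y ` E) = y (u, v)" by auto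
  have mx: "y q \<le> y (u, v)" if "q \<in> E" for q
    unfolding uv(2)[symmetric] using finE that by (intro Max_ge) auto
  define m where "m = y (u, v)"
  have "y (s, t) > 0" using t by (simp add: y_def)
  then have m: "m > 0" using mx[OF \<open>(s, t) \<in> E\<close>] unfolding m_def by linarith
  have le: "\<bar>x a + x b\<bar> \<le> m" if "adj G a b" for a b
    using mx[of "(a, b)"] that unfolding m_def y_def E_def by simp
  have bound: "\<bar>\<Sum>v\<in>nbrs G a. x a + x v\<bar> \<le> real (degree G a) * m" for a
  proof -
    have "\<bar>\<Sum>v\<in>nbrs G a. x a + x v\<bar> \<le> (\<Sum>v\<in>nbrs G a. \<bar>x a + x v\<bar>)"
      by (rule sum_abs)
    also have "\<dots> \<le> (\<Sum>v\<in>nbrs G a. m)"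
      using le by (intro sum_mono) (auto simp: nbrs_def)
    finally show ?thesis by (simp add: degree_eq_card_nbrs[OF G])
  qed
  have sumeq: "\<mu> * (x a + x b) = (\<Sum>v\<in>nbrs G a. x a + x v) + (\<Sum>v\<in>nbrs G b. x b + x v)"
    if "adj G a b" for a b
    using x adj_simple_graph[OF G that] by (simp add: distrib_left)
  have tight: "real (degree G a) + real (degree G b) = \<mu> \<and>
      \<bar>\<Sum>v\<in>nbrs G a. x a + x v\<bar> = real (degree G a) * m"
    if ab: "adj G a b" "\<bar>x a + x b\<bar> = m" for a b
  proof -
    \<comment> \<open>The chain runs from \<open>\<mu> * m\<close> through the two row sums and the
      degree sum times \<open>m\<close> back to \<open>\<mu> * m\<close>, so every inequality in it
      is an equality.\<close>
    have "\<mu> * m = \<bar>\<mu> * (x a + x b)\<bar>" using ab \<open>\<mu> > 0\<close> by (simp add: abs_mult)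
    also have "\<dots> \<le> \<bar>\<Sum>v\<in>nbrs G a. x a + x v\<bar> + \<bar>\<Sum>v\<in>nbrs G b. x b + x v\<bar>"
      unfolding sumeq[OF ab(1)] by (rule abs_triangle_ineq)
    finally have 1: "\<mu> * m \<le> \<bar>\<Sum>v\<in>nbrs G a. x a + x v\<bar> + \<bar>\<Sum>v\<in>nbrs G b. x b + x v\<bar>" .
    have "(real (degree G a) + real (degree G b)) * m \<le> \<mu> * m"
      using deg[OF ab(1)] m by (intro mult_right_mono) auto
    then have 2: "real (degree G a) * m + real (degree G b) * m \<le> \<mu> * m"
      by (simp add: distrib_right)
    have "(real (degree G a) + real (degree G b)) * m = \<mu> * m"
      using 1 2 bound[of a] bound[of b] unfolding distrib_right by linarith
    then show ?thesis using 1 2 bound[of a] bound[of b] m by auto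
  qed
  have uv': "adj G u v" "\<bar>x u + x v\<bar> = m"
    using uv by (auto simp: E_def m_def y_def)
  have "real (degree G u) + real (degree G w) = \<mu>" if w: "adj G u w" for w
  proof -
    have "\<bar>x u + x w\<bar> = m"
    proof (rule ccontr)
      assume "\<bar>x u + x w\<bar> \<noteq> m"
      then have "\<bar>x u + x w\<bar> < m" using le[OF w] by simp
      then have "(\<Sum>v\<in>nbrs G u. \<bar>x u + x v\<bar>) < (\<Sum>v\<in>nbrs G u. m)"
        using w le finite_nbrs[OF G] by (intro sum_strict_mono_ex1) (auto simp: nbrs_def)
      then have "\<bar>\<Sum>v\<in>nbrs G u. x u + x v\<bar> < real (degree G u) * m"
        using sum_abs[of "\<lambda>v. x u + x v" "nbrs G u"] unfolding degree_eq_card_nbrs[OF G] sum_constant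
        by linarith
      then show False using tight[OF uv'] by simp
    qed
    then show ?thesis using tight[OF w] by simp
  qed
  then show ?thesis using that uv'(1) by blast
qed

text \<open>Degree sums along edges are at most \<open>n\<close>, hence at most the
  \<open>Q\<close>-index, and tightness around one vertex \<open>u\<close> makes
  \<open>nbrs G u\<close> and its complement the sides of a complete bipartite graph.\<close>

lemma triangle_free_outerplanar_Q_index_imp_star:
  assumes G: "simple_graph G" and n: "card (verts G) = n" "n \<ge> 5"
    and out: "outerplanar G" and free: "\<not> contains_subgraph G C3" and Q: "real n \<le> Q_index G"
  shows "graph_iso G (star_graph n)"
proof -
  have fin: "finite (verts G)" using G by (simp add: simple_graph_def)
  have tri: False if "adj G a b" "adj G b c" "adj G a c" for a b c
    using contains_C3I[OF G that] free by blast
  have disj: "nbrs G a \<inter> nbrs G b = {}" if "adj G a b" for a b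
    using tri that by (auto simp: nbrs_def adj_commute)
  have sub: "nbrs G a \<subseteq> verts G" for a
    using adj_simple_graph[OF G] by (auto simp: nbrs_def)
  have deg: "degree G a + degree G b = card (nbrs G a \<union> nbrs G b)" if "adj G a b" for a b
    using disj[OF that] finite_nbrs[OF G] by (simp add: degree_eq_card_nbrs[OF G] card_Un_disjoint)
  have deg_le: "degree G a + degree G b \<le> n" if "adj G a b" for a b
    unfolding deg[OF that] n(1)[symmetric] using sub fin by (intro card_mono) auto
  have "verts G \<noteq> {}" using n by auto
  then have eig: "is_Q_eigenvalue G (Q_index G)" using G by (rule Q_index_is_eigenvalue[rotated])
  have le: "real (degree G a) + real (degree G b) \<le> Q_index G" if "adj G a b" for a b
    using deg_le[OF that] Q by linarith
  have Qpos: "Q_index G > 0" using Q n by linarith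
  obtain u v where uv: "adj G u v"
    and uw: "\<And>w. adj G u w \<Longrightarrow> real (degree G u) + real (degree G w) = Q_index G"
    using Q_eigenvalue_ge_degree_sums_tight[OF G eig Qpos le] by blast
  \<comment> \<open>The degree sum at the edge \<open>u w\<close> is at least \<open>n\<close>, so
    the disjoint neighbourhoods of \<open>u\<close> and \<open>w\<close> exhaust the
    vertices.\<close>
  have cover: "nbrs G w = verts G - nbrs G u" if w: "adj G u w" for w
  proof -
    have "card (verts G) \<le> card (nbrs G u \<union> nbrs G w)"
      using uw[OF w] Q deg[OF w] n by linarith
    then have "nbrs G u \<union> nbrs G w = verts G"
      using sub fin by (intro card_seteq) auto
    then show ?thesis using disj[OF w] by blast
  qed
  define A where "A = nbrs G u"
  define B where "B = verts G - A"
  have A: "A \<subseteq> verts G" "v \<in> A" using sub uv by (auto simp: A_def nbrs_def)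
  have uB: "u \<in> B"
    using adj_simple_graph(1)[OF G uv] adj_simple_graph(3)[OF G, of u u] by (auto simp: B_def A_def nbrs_def)
  have AB: "adj G a b \<longleftrightarrow> b \<in> B" if "a \<in> A" for a b
    using cover[of a] that by (auto simp: A_def B_def nbrs_def)
  have BA: "adj G b a \<longleftrightarrow> a \<in> A" if b: "b \<in> B" for a b
  proof
    assume ba: "adj G b a"
    show "a \<in> A"
    proof (rule ccontr)
      assume "a \<notin> A"
      then have "a \<in> B" using adj_simple_graph[OF G ba] by (simp add: B_def)
      \<comment> \<open>\<open>v\<close> lies in \<open>A\<close> and is adjacent to all of
        \<open>B\<close>, so an edge within \<open>B\<close> closes a triangle.\<close>
      then show False using tri[of v b a] AB[OF A(2)] b ba by blast
    qed
  next
    assume "a \<in> A"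
    then show "adj G b a" using AB b adj_commute by metis
  qed
  have cards: "card A + card B = n"
    using card_Diff_subset[of A "verts G"] finite_subset[OF A(1) fin] A(1) n(1) card_mono[OF fin A(1)]
    unfolding B_def by simp
  have finA: "finite A" and finB: "finite B" using fin A finite_subset by (auto simp: B_def)
  have no23: False if X: "card X \<ge> 2" and Y: "card Y \<ge> 3"
    and XY: "\<And>a b. a \<in> X \<Longrightarrow> b \<in> Y \<Longrightarrow> adj G a b" for X Y
  proof -
    obtain X' where X': "X' \<subseteq> X" "card X' = 2" using X by (meson obtain_subset_with_card_n)
    obtain Y' where Y': "Y' \<subseteq> Y" "card Y' = 3" using Y by (meson obtain_subset_with_card_n)
    obtain a a' where a: "X' = {a, a'}" "a \<noteq> a'" using X' by (auto simp: card_2_iff)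
    obtain w1 w2 w3 where w: "Y' = {w1, w2, w3}" "w1 \<noteq> w2" "w1 \<noteq> w3" "w2 \<noteq> w3"
      using Y' by (auto simp: card_3_iff)
    have "\<forall>w\<in>{w1, w2, w3}. adj G a w \<and> adj G w a'"
      using XY[of a] XY[of a', THEN adj_commute[THEN iffD1]] X'(1) Y'(1) unfolding a(1) w(1) by blast
    then show False using outerplanar_no_K23[OF G out a(2) w(2,3,4)] by blast
  qed
  \<comment> \<open>Two sides of size at least 2 with total at least 5 include one of size at least
    3, which gives a forbidden pair of sides; hence one side is a single vertex.\<close>
  have "card A \<noteq> 0" "card B \<noteq> 0" using A uB finA finB by auto
  moreover have "\<not> (card A \<ge> 2 \<and> card B \<ge> 3)" using no23[of A B] AB by blast
  moreover have "\<not> (card B \<ge> 2 \<and> card A \<ge> 3)" using no23[of B A] BA by blast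
  ultimately have "card A = 1 \<or> card B = 1" using cards n by linarith
  then show ?thesis
  proof
    assume "card A = 1"
    then have Av: "A = {v}" using A by (auto simp: card_1_singleton_iff)
    show ?thesis
      by (rule graph_iso_star_graphI[OF G n(1), of v]) (use A AB BA Av in \<open>auto simp: B_def\<close>)
  next
    assume "card B = 1"
    then have Bu: "B = {u}" using uB by (auto simp: card_1_singleton_iff)
    have "u \<in> verts G" using uB by (simp add: B_def)
    moreover have "w \<in> A \<longleftrightarrow> w \<noteq> u" if "w \<in> verts G" for w
      using that Bu by (auto simp: B_def)
    ultimately show ?thesis
      by (intro graph_iso_star_graphI[OF G n(1), of u]) (use AB BA Bu in \<open>auto dest: adj_simple_graph(3)[OF G]\<close>)
  qed
qed

theorem theorem3p1:
  fixes n :: nat and F :: "nat graph" and G :: "'a graph"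
  assumes "n \<ge> 5"
    and "F \<in> {P4, two_K2, C3}"
    and "simple_graph G" and "card (verts G) = n"
    and "connected_graph G" and "outerplanar G" and "\<not> contains_subgraph G F"
    and "\<forall>H :: nat graph. simple_graph H \<and> card (verts H) = n \<and> connected_graph H \<and>
           outerplanar H \<and> \<not> contains_subgraph H F \<longrightarrow> Q_index H \<le> Q_index G"
  shows "graph_iso G (star_graph n)"
proof (cases "F = C3")
  case True
  \<comment> \<open>Competitors range over graphs on the naturals, so \<open>star_graph n\<close>
    itself qualifies.\<close>
  have "Q_index (star_graph n) \<le> Q_index G"
    using assms(1) True
    by (intro assms(8)[rule_format])
      (simp add: simple_star_graph connected_star_graph outerplanar_star_graph star_graph_no_C3)
  moreover have "real n \<le> Q_index (star_graph n)"
    using assms(1) by (intro Q_index_ge simple_star_graph is_Q_eigenvalue_star_graph) simp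
  ultimately show ?thesis
    using triangle_free_outerplanar_Q_index_imp_star[OF assms(3,4,1,6)] assms(7) True by simp
next
  case False
  then have "\<not> contains_subgraph G P4"
    using assms(2,7) contains_P4_imp_two_K2 by blast
  then show ?thesis
    using connected_P4_free_imp_star[OF assms(3,4) _ assms(5)] assms(1) by simp
qed

end
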